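(* Let $n\ge1$. The set $$\mathcal{D}_n=\big\{\Delta_{C(\alpha)} : \alpha\in\{0,1\}^n \text{ a ballot sequence}\big\}$$ is contained in $EQH_n$ and is linearly independent (with the elements $\Delta_{C(\alpha)}$ indexed by the ballot sequences $\alpha$).
   Context: Let $R_n=\mathbb{Q}[\theta_1,\dots,\theta_n]$ be the polynomial ring in anticommuting variables over $\mathbb{Q}$ (exterior algebra): $\theta_i\theta_j=-\theta_j\theta_i$ for $i\ne j$, $\theta_i^2=0$. For $A=\{a_1<\cdots<a_r\}\subseteq[n]$ put $\theta_A=\theta_{a_1}\cdots\theta_{a_r}$, and $F_{1^r}=\sum_{A\subseteq[n],|A|=r}\theta_A$. Let $I_n$ be the ideal of $R_n$ generated by $F_{1^r}$, $1\le r\le n$. Operators $\partial_{\theta_i}$ on $R_n$: $\partial_{\theta_i}(\theta_A)=(-1)^{\#\{j\in A: j<i\}}\theta_{A\setminus\{i\}}$ if $i\in A$, and $0$ otherwise. The inner product on $R_n$ is $\langle p,q\rangle=\overline{p(\partial_{\theta_1},\dots,\partial_{\theta_n})}\,q(\theta_1,\dots,\theta_n)|_{\theta_1=\cdots=\theta_n=0}$, where the bar reverses the order of the factors in every monomial; the monomials $\theta_A$ are an orthonormal basis for it. Define $EQH_n=\{q\in R_n:\langle p,q\rangle=0\text{ for all }p\in I_n\}$. A ballot sequence is $\alpha=(a_1,\dots,a_n)\in\{0,1\}^n$ with $\sum_{i=1}^r a_i\le r/2$ for all $1\le r\le n$. Given a ballot sequence $\alpha$, replace each $0$ by an open parenthesis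 and each $1$ by a closing parenthesis and perform the usual maximal matching of parentheses (every closing parenthesis gets matched; some open ones may remain unmatched). Let $C(\alpha)=((i_1,j_1),\dots,(i_k,j_k))$ be the list of matched pairs of positions ($i_r<j_r$, $i_r$ the open and $j_r$ the closing parenthesis), ordered so that $j_1<j_2<\cdots<j_k$. E.g. $\alpha=0010001101$ gives $C(\alpha)=((2,3),(6,7),(5,8),(9,10))$. Define $\Delta_{C(\alpha)}=(\theta_{j_1}-\theta_{i_1})(\theta_{j_2}-\theta_{i_2})\cdots(\theta_{j_k}-\theta_{i_k})$, with $\Delta_{C(\alpha)}=1$ if $k=0$. *)

theory Defs
  imports Complex_Main "HOL-Algebra.Ideal"
begin

(* An element of the exterior algebra is given by its coefficients: p A is the
   coefficient of theta_A.  Only the coefficients with A \<subseteq> {1..n} may be nonzero. *)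

definition crossings :: "nat set \<Rightarrow> nat set \<Rightarrow> nat" where
  "crossings A B = card {(a, b). a \<in> A \<and> b \<in> B \<and> b < a}"

(* For disjoint A and B, sorting theta_A theta_B into theta_(A \<union> B) takes
   crossings A B adjacent transpositions; for non-disjoint A and B the product is 0. *)
definition ext_mult :: "(nat set \<Rightarrow> rat) \<Rightarrow> (nat set \<Rightarrow> rat) \<Rightarrow> nat set \<Rightarrow> rat" where
  "ext_mult p q C = (\<Sum>A \<in> Pow C. (- 1) ^ crossings A (C - A) * p A * q (C - A))"

definition theta_mon :: "nat set \<Rightarrow> nat set \<Rightarrow> rat" where
  "theta_mon A = (\<lambda>B. if B = A then 1 else 0)"

definition theta :: "nat \<Rightarrow> nat set \<Rightarrow> rat" where
  "theta i = theta_mon {i}"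

definition ext_ring :: "nat \<Rightarrow> (nat set \<Rightarrow> rat) ring" where
  "ext_ring n =
    \<lparr>carrier = {p. \<forall>A. \<not> A \<subseteq> {1..n} \<longrightarrow> p A = 0},
     mult = ext_mult, one = theta_mon {},
     zero = (\<lambda>A. 0), add = (\<lambda>p q A. p A + q A)\<rparr>"

definition ext_smult :: "rat \<Rightarrow> (nat set \<Rightarrow> rat) \<Rightarrow> nat set \<Rightarrow> rat" where
  "ext_smult c p = (\<lambda>A. c * p A)"

definition F_ones :: "nat \<Rightarrow> nat \<Rightarrow> nat set \<Rightarrow> rat" where
  "F_ones n r = (\<Oplus>\<^bsub>ext_ring n\<^esub>A \<in> {A. A \<subseteq> {1..n} \<and> card A = r}. theta_mon A)"

definition I_ideal :: "nat \<Rightarrow> (nat set \<Rightarrow> rat) set" where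
  "I_ideal n = Idl\<^bsub>ext_ring n\<^esub> (F_ones n ` {1..n})"

definition d_theta_mon :: "nat \<Rightarrow> nat set \<Rightarrow> nat set \<Rightarrow> rat" where
  "d_theta_mon i A =
    (if i \<in> A then ext_smult ((- 1) ^ card {j \<in> A. j < i}) (theta_mon (A - {i})) else (\<lambda>B. 0))"

definition d_theta :: "nat \<Rightarrow> nat \<Rightarrow> (nat set \<Rightarrow> rat) \<Rightarrow> nat set \<Rightarrow> rat" where
  "d_theta n i q = (\<Oplus>\<^bsub>ext_ring n\<^esub>A \<in> Pow {1..n}. ext_smult (q A) (d_theta_mon i A))"

(* For A = {a_1 < ... < a_r}, the reversed monomial in the operators is
   d_(a_r) o ... o d_(a_1), which applies d_(a_1) first; this is what fold does. *)
definition d_bar_mon :: "nat \<Rightarrow> nat set \<Rightarrow> (nat set \<Rightarrow> rat) \<Rightarrow> nat set \<Rightarrow> rat" where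
  "d_bar_mon n A q = fold (d_theta n) (sorted_list_of_set A) q"

(* Setting all theta_i to 0 leaves the coefficient of theta_{}. *)
definition ext_inner :: "nat \<Rightarrow> (nat set \<Rightarrow> rat) \<Rightarrow> (nat set \<Rightarrow> rat) \<Rightarrow> rat" where
  "ext_inner n p q =
    (\<Oplus>\<^bsub>ext_ring n\<^esub>A \<in> Pow {1..n}. ext_smult (p A) (d_bar_mon n A q)) {}"

definition EQH :: "nat \<Rightarrow> (nat set \<Rightarrow> rat) set" where
  "EQH n = {q \<in> carrier (ext_ring n). \<forall>p \<in> I_ideal n. ext_inner n p q = 0}"

definition ballot :: "nat \<Rightarrow> nat list set" where
  "ballot n = {\<alpha>. length \<alpha> = n \<and> set \<alpha> \<subseteq> {0, 1} \<and>
     (\<forall>r \<in> {1..n}. real (sum_list (take r \<alpha>)) \<le> real r / 2)}"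

(* Left-to-right scan: k is the current position, the second argument is the stack of
   the positions of the currently open parentheses (innermost first).  A pair is emitted
   when its closing parenthesis is read, so the pairs come ordered by that position. *)
fun match_scan :: "nat \<Rightarrow> nat list \<Rightarrow> nat list \<Rightarrow> (nat \<times> nat) list" where
  "match_scan k st [] = []"
| "match_scan k st (a # as) =
    (if a = 0 then match_scan (Suc k) (k # st) as
     else (case st of
             [] \<Rightarrow> match_scan (Suc k) [] as
           | i # st' \<Rightarrow> (i, k) # match_scan (Suc k) st' as))"

definition matching :: "nat list \<Rightarrow> (nat \<times> nat) list" where
  "matching \<alpha> = match_scan 1 [] \<alpha>"

lemma matching_example:
  "matching [0,0,1,0,0,0,1,1,0,1] = [(2,3), (6,7), (5,8), (9,10)]"
  by (simp add: matching_def)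

definition Delta :: "nat \<Rightarrow> nat list \<Rightarrow> nat set \<Rightarrow> rat" where
  "Delta n \<alpha> =
    foldr (mult (ext_ring n))
      (map (\<lambda>(i, j). theta j \<ominus>\<^bsub>ext_ring n\<^esub> theta i) (matching \<alpha>)) \<one>\<^bsub>ext_ring n\<^esub>"

section \<open>The exterior algebra is a ring generated by anticommuting variables\<close>

lemma crossings_Un_left:
  assumes "finite A" "finite B" "finite C" "A \<inter> B = {}"
  shows "crossings (A \<union> B) C = crossings A C + crossings B C"
proof -
  have fin: "finite {(a, b). a \<in> X \<and> b \<in> C \<and> b < a}" if "finite X" for X :: "nat set"
    by (rule finite_subset[of _ "X \<times> C"]) (use that assms in auto)
  have "{(a, b). a \<in> A \<union> B \<and> b \<in> C \<and> b < a} =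
      {(a, b). a \<in> A \<and> b \<in> C \<and> b < a} \<union> {(a, b). a \<in> B \<and> b \<in> C \<and> b < a}" by auto
  then show ?thesis
    unfolding crossings_def using fin assms
    by (simp only:) (subst card_Un_disjoint, auto)
qed

lemma crossings_Un_right:
  assumes "finite A" "finite B" "finite C" "A \<inter> B = {}"
  shows "crossings C (A \<union> B) = crossings C A + crossings C B"
proof -
  have fin: "finite {(a, b). a \<in> C \<and> b \<in> X \<and> b < a}" if "finite X" for X :: "nat set"
    by (rule finite_subset[of _ "C \<times> X"]) (use that assms in auto)
  have "{(a, b). a \<in> C \<and> b \<in> A \<union> B \<and> b < a} =
      {(a, b). a \<in> C \<and> b \<in> A \<and> b < a} \<union> {(a, b). a \<in> C \<and> b \<in> B \<and> b < a}" by auto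
  then show ?thesis
    unfolding crossings_def using fin assms
    by (simp only:) (subst card_Un_disjoint, auto)
qed

lemma crossings_empty [simp]: "crossings {} A = 0" "crossings A {} = 0"
  by (simp_all add: crossings_def)

lemma ext_mult_infinite: "infinite C \<Longrightarrow> ext_mult p q C = 0"
  by (simp add: ext_mult_def)

lemma ext_mult_assoc: "ext_mult (ext_mult p q) r = ext_mult p (ext_mult q r)"
proof
  fix D :: "nat set"
  show "ext_mult (ext_mult p q) r D = ext_mult p (ext_mult q r) D"
  proof (cases "finite D")
    case False
    then show ?thesis by (simp add: ext_mult_infinite)
  next
    case True
    have fin: "finite X" if "X \<subseteq> D" for X using True that by (rule rev_finite_subset)
    let ?s = "\<lambda>A B. (- 1 :: rat) ^ crossings A B"
    have "ext_mult (ext_mult p q) r D =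
        (\<Sum>S\<in>Pow D. \<Sum>A\<in>Pow S. ?s S (D - S) * ?s A (S - A) * p A * q (S - A) * r (D - S))"
      unfolding ext_mult_def by (simp add: sum_distrib_left sum_distrib_right mult_ac)
    also have "\<dots> = (\<Sum>(S, A)\<in>Sigma (Pow D) Pow.
        ?s S (D - S) * ?s A (S - A) * p A * q (S - A) * r (D - S))"
      by (rule sum.Sigma) (use True fin in auto)
    also have "\<dots> = (\<Sum>(A, B)\<in>Sigma (Pow D) (\<lambda>A. Pow (D - A)).
        ?s A (D - A) * ?s B (D - A - B) * p A * q B * r (D - A - B))"
    proof (rule sum.reindex_bij_witness[where i = "\<lambda>(A, B). (A \<union> B, A)" and j = "\<lambda>(S, A). (A, S - A)"],
        goal_cases)
      case (5 x)
      obtain S A where x: "x = (S, A)" by (cases x)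
      with 5 have SA: "S \<subseteq> D" "A \<subseteq> S" by auto
      have e: "D - A - (S - A) = D - S" using SA by auto
      have "crossings S (D - S) = crossings A (D - S) + crossings (S - A) (D - S)"
        using crossings_Un_left[of A "S - A" "D - S"] SA fin True
        by (metis Diff_disjoint Un_Diff_cancel finite_Diff finite_subset sup.absorb_iff2)
      moreover have "crossings A (D - A) = crossings A (S - A) + crossings A (D - S)"
      proof -
        have "D - A = (S - A) \<union> (D - S)" using SA by auto
        then show ?thesis
          using crossings_Un_right[of "S - A" "D - S" A] SA fin True
          by (metis Diff_disjoint Diff_subset finite_Diff finite_subset inf.orderE inf_assoc inf_bot_right)
      qed
      ultimately show ?case unfolding x by (simp add: e power_add)
    qed auto
    also have "\<dots> = (\<Sum>A\<in>Pow D. \<Sum>B\<in>Pow (D - A).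
        ?s A (D - A) * ?s B (D - A - B) * p A * q B * r (D - A - B))"
      by (rule sum.Sigma[symmetric]) (use True fin in auto)
    also have "\<dots> = ext_mult p (ext_mult q r) D"
      unfolding ext_mult_def by (simp add: sum_distrib_left sum_distrib_right mult_ac)
    finally show ?thesis .
  qed
qed

lemma ext_mult_one_left:
  assumes "infinite A \<Longrightarrow> p A = 0"
  shows "ext_mult (theta_mon {}) p A = p A"
proof (cases "finite A")
  case True
  have "ext_mult (theta_mon {}) p A = (\<Sum>B\<in>Pow A. if B = {} then p A else 0)"
    unfolding ext_mult_def theta_mon_def by (rule sum.cong) auto
  then show ?thesis using True by simp
qed (simp add: ext_mult_infinite assms)

lemma ext_mult_one_right:
  assumes "infinite A \<Longrightarrow> p A = 0"
  shows "ext_mult p (theta_mon {}) A = p A"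
proof (cases "finite A")
  case True
  have "ext_mult p (theta_mon {}) A = (\<Sum>B\<in>Pow A. if B = A then p A else 0)"
    unfolding ext_mult_def theta_mon_def by (rule sum.cong) auto
  then show ?thesis using True by simp
qed (simp add: ext_mult_infinite assms)

lemma ext_mult_closed:
  assumes "\<And>A. \<not> A \<subseteq> S \<Longrightarrow> p A = 0" "\<And>A. \<not> A \<subseteq> S \<Longrightarrow> q A = 0" "\<not> C \<subseteq> S"
  shows "ext_mult p q C = 0"
  unfolding ext_mult_def
proof (rule sum.neutral, intro ballI)
  fix A assume "A \<in> Pow C"
  then have "\<not> A \<subseteq> S \<or> \<not> C - A \<subseteq> S" using assms(3) by auto
  then have "p A = 0 \<or> q (C - A) = 0" using assms(1,2) by blast
  then show "(- 1) ^ crossings A (C - A) * p A * q (C - A) = 0" by auto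
qed

lemma ring_ext_ring: "ring (ext_ring n)"
proof (rule ringI)
  show "abelian_group (ext_ring n)"
  proof (rule abelian_groupI)
    fix p assume "p \<in> carrier (ext_ring n)"
    then show "\<exists>q\<in>carrier (ext_ring n). q \<oplus>\<^bsub>ext_ring n\<^esub> p = \<zero>\<^bsub>ext_ring n\<^esub>"
      by (intro bexI[of _ "\<lambda>A. - p A"]) (auto simp: ext_ring_def)
  qed (auto simp: ext_ring_def add_ac)
  have inf: "p A = 0" if "p \<in> carrier (ext_ring n)" "infinite A" for p A
    using that finite_subset[of A "{1..n}"] by (auto simp: ext_ring_def)
  show "Group.monoid (ext_ring n)"
  proof (rule monoidI)
    fix p q assume "p \<in> carrier (ext_ring n)" "q \<in> carrier (ext_ring n)"
    then show "p \<otimes>\<^bsub>ext_ring n\<^esub> q \<in> carrier (ext_ring n)"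
      using ext_mult_closed[of "{1..n}" p q] by (auto simp: ext_ring_def)
  next
    show "\<one>\<^bsub>ext_ring n\<^esub> \<in> carrier (ext_ring n)" by (auto simp: ext_ring_def theta_mon_def)
  next
    fix p assume "p \<in> carrier (ext_ring n)"
    note i = inf[OF this]
    show "\<one>\<^bsub>ext_ring n\<^esub> \<otimes>\<^bsub>ext_ring n\<^esub> p = p"
      using ext_mult_one_left[of _ p] i by (auto simp: ext_ring_def)
    show "p \<otimes>\<^bsub>ext_ring n\<^esub> \<one>\<^bsub>ext_ring n\<^esub> = p"
      using ext_mult_one_right[of _ p] i by (auto simp: ext_ring_def)
  qed (simp add: ext_ring_def ext_mult_assoc)
qed (auto simp: ext_ring_def ext_mult_def algebra_simps sum.distrib)

lemma theta_mon_mult: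
  assumes "finite A" "finite B"
  shows "ext_mult (theta_mon A) (theta_mon B) =
    (if A \<inter> B = {} then ext_smult ((- 1) ^ crossings A B) (theta_mon (A \<union> B)) else (\<lambda>C. 0))"
proof
  fix C
  show "ext_mult (theta_mon A) (theta_mon B) C =
    (if A \<inter> B = {} then ext_smult ((- 1) ^ crossings A B) (theta_mon (A \<union> B)) else (\<lambda>C. 0)) C"
  proof (cases "finite C")
    case False
    then show ?thesis using assms by (auto simp: ext_mult_infinite ext_smult_def theta_mon_def)
  next
    case True
    have "ext_mult (theta_mon A) (theta_mon B) C =
        (\<Sum>X\<in>Pow C. if X = A then (if C - A = B then (- 1) ^ crossings A B else 0) else 0)"
      unfolding ext_mult_def theta_mon_def by (rule sum.cong) auto
    also have "\<dots> = (if A \<subseteq> C \<and> C - A = B then (- 1) ^ crossings A B else 0)"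
      using True by auto
    also have "(A \<subseteq> C \<and> C - A = B) = (A \<inter> B = {} \<and> C = A \<union> B)" by auto
    finally show ?thesis by (auto simp: ext_smult_def theta_mon_def)
  qed
qed

lemma theta_square: "ext_mult (theta i) (theta i) = (\<lambda>A. 0)"
  by (simp add: theta_def theta_mon_mult)

lemma theta_anticommute:
  assumes "i \<noteq> j"
  shows "ext_mult (theta i) (theta j) = (\<lambda>A. - ext_mult (theta j) (theta i) A)"
proof -
  have "crossings {a} {b} = (if b < a then 1 else 0)" for a b
  proof -
    have "{(x, y). x \<in> {a} \<and> y \<in> {b} \<and> y < x} = (if b < a then {(a, b)} else {})" by auto
    then show ?thesis by (simp add: crossings_def)
  qed
  then show ?thesis
    using assms by (auto simp: theta_def theta_mon_mult ext_smult_def insert_commute fun_eq_iff)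
qed

lemma theta_mon_eq_prod:
  assumes "finite A"
  shows "theta_mon A = foldr ext_mult (map theta (sorted_list_of_set A)) (theta_mon {})"
proof -
  have "foldr ext_mult (map theta xs) (theta_mon {}) = theta_mon (set xs)"
    if "sorted_wrt (<) xs" for xs
    using that
  proof (induction xs)
    case (Cons x xs)
    have "{(a, b). a \<in> {x} \<and> b \<in> set xs \<and> b < a} = {}" using Cons.prems by auto
    then have "crossings {x} (set xs) = 0" unfolding crossings_def by (simp only: card.empty)
    moreover have "x \<notin> set xs" using Cons.prems by auto
    ultimately show ?case
      using Cons by (simp add: theta_def theta_mon_mult ext_smult_def)
  qed simp
  from this[of "sorted_list_of_set A"] show ?thesis using assms by simp
qed

section \<open>The monomials are orthonormal, and all sums used above are well-defined\<close>

lemma finsum_ext_ring: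
  assumes "finite X" "f \<in> X \<rightarrow> carrier (ext_ring n)"
  shows "(\<Oplus>\<^bsub>ext_ring n\<^esub>x \<in> X. f x) = (\<lambda>B. \<Sum>x\<in>X. f x B)"
proof -
  interpret ring "ext_ring n" by (rule ring_ext_ring)
  show ?thesis using assms
  proof (induction X rule: finite_induct)
    case (insert x X)
    then have "(\<Oplus>\<^bsub>ext_ring n\<^esub>x \<in> insert x X. f x) = f x \<oplus>\<^bsub>ext_ring n\<^esub> (\<Oplus>\<^bsub>ext_ring n\<^esub>x \<in> X. f x)"
      by (intro finsum_insert) auto
    with insert show ?case by (simp add: ext_ring_def)
  qed (simp, simp add: ext_ring_def)
qed

lemma ext_smult_closed:
  "p \<in> carrier (ext_ring n) \<Longrightarrow> ext_smult c p \<in> carrier (ext_ring n)"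
  by (auto simp: ext_ring_def ext_smult_def)

lemma theta_mon_closed: "A \<subseteq> {1..n} \<Longrightarrow> theta_mon A \<in> carrier (ext_ring n)"
  by (auto simp: ext_ring_def theta_mon_def)

lemma d_theta_mon_closed: "A \<subseteq> {1..n} \<Longrightarrow> d_theta_mon i A \<in> carrier (ext_ring n)"
  unfolding d_theta_mon_def
  by (auto intro!: ext_smult_closed theta_mon_closed) (auto simp: ext_ring_def)

lemma d_theta_eq_sum:
  "d_theta n i q = (\<lambda>B. \<Sum>A\<in>Pow {1..n}. q A * d_theta_mon i A B)"
proof -
  have "(\<lambda>A. ext_smult (q A) (d_theta_mon i A)) \<in> Pow {1..n} \<rightarrow> carrier (ext_ring n)"
    by (intro Pi_I ext_smult_closed d_theta_mon_closed) auto
  then show ?thesis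
    unfolding d_theta_def by (subst finsum_ext_ring) (auto simp: ext_smult_def)
qed

lemma d_theta_closed: "d_theta n i q \<in> carrier (ext_ring n)"
  using d_theta_mon_closed[of _ n i] unfolding d_theta_eq_sum
  by (auto simp: ext_ring_def intro!: sum.neutral)

lemma d_theta_coeff:
  assumes "i \<in> {1..n}" "B \<subseteq> {1..n}" "i \<notin> B"
  shows "d_theta n i q B = (- 1) ^ card {j \<in> B. j < i} * q (insert i B)"
proof -
  have "d_theta n i q B =
      (\<Sum>A\<in>Pow {1..n}. if A = insert i B then (- 1) ^ card {j \<in> B. j < i} * q (insert i B) else 0)"
    unfolding d_theta_eq_sum
  proof (rule sum.cong, rule refl)
    fix A
    have "{j \<in> insert i B. j < i} = {j \<in> B. j < i}" by auto
    then show "q A * d_theta_mon i A B =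
        (if A = insert i B then (- 1) ^ card {j \<in> B. j < i} * q (insert i B) else 0)"
      using assms(3) by (auto simp: d_theta_mon_def ext_smult_def theta_mon_def insert_absorb)
  qed
  then show ?thesis using assms by simp
qed

lemma d_bar_mon_closed: "q \<in> carrier (ext_ring n) \<Longrightarrow> d_bar_mon n A q \<in> carrier (ext_ring n)"
proof -
  have "fold (d_theta n) xs q \<in> carrier (ext_ring n)" if "q \<in> carrier (ext_ring n)" for xs q
    using that by (induction xs arbitrary: q) (auto intro: d_theta_closed)
  then show "q \<in> carrier (ext_ring n) \<Longrightarrow> d_bar_mon n A q \<in> carrier (ext_ring n)"
    by (simp add: d_bar_mon_def)
qed

lemma d_bar_mon_const_coeff:
  assumes "A \<subseteq> {1..n}"
  shows "d_bar_mon n A q {} = q A"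
proof -
  have "fold (d_theta n) xs q {} = q (set xs)" if "sorted_wrt (<) xs" "set xs \<subseteq> {1..n}" for xs q
    using that
  proof (induction xs arbitrary: q)
    case (Cons x xs)
    have "{j \<in> set xs. j < x} = {}" using Cons.prems by auto
    moreover have "x \<notin> set xs" using Cons.prems by auto
    ultimately have "d_theta n x q (set xs) = q (insert x (set xs))"
      using Cons.prems d_theta_coeff[of x n "set xs" q]
      by (metis (no_types, lifting) card.empty list.set_intros(1) list.simps(15)
          mult_1 power_0 set_subset_Cons subset_iff)
    then show ?case using Cons by simp
  qed simp
  from this[of "sorted_list_of_set A"] show ?thesis
    using assms finite_subset[OF assms] by (simp add: d_bar_mon_def)
qed

lemma ext_inner_eq_sum:
  assumes "q \<in> carrier (ext_ring n)"
  shows "ext_inner n p q = (\<Sum>A\<in>Pow {1..n}. p A * q A)"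
proof -
  have "(\<lambda>A. ext_smult (p A) (d_bar_mon n A q)) \<in> Pow {1..n} \<rightarrow> carrier (ext_ring n)"
    using assms by (intro Pi_I ext_smult_closed d_bar_mon_closed)
  then have "ext_inner n p q = (\<Sum>A\<in>Pow {1..n}. ext_smult (p A) (d_bar_mon n A q) {})"
    unfolding ext_inner_def by (subst finsum_ext_ring) auto
  also have "\<dots> = (\<Sum>A\<in>Pow {1..n}. p A * q A)"
    by (rule sum.cong) (auto simp: ext_smult_def d_bar_mon_const_coeff)
  finally show ?thesis .
qed

lemma ext_inner_theta_mon:
  assumes "A \<subseteq> {1..n}" "B \<subseteq> {1..n}"
  shows "ext_inner n (theta_mon A) (theta_mon B) = (if A = B then 1 else 0)"
proof -
  have "ext_inner n (theta_mon A) (theta_mon B) =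
      (\<Sum>X\<in>Pow {1..n}. if X = A then (if A = B then 1 else 0) else 0)"
    unfolding ext_inner_eq_sum[OF theta_mon_closed[OF assms(2)]]
    by (rule sum.cong) (auto simp: theta_mon_def)
  then show ?thesis using assms by simp
qed

lemma finite_ballot: "finite (ballot n)"
  by (rule finite_subset[OF _ finite_lists_length_eq[of "{0, 1}" n]]) (auto simp: ballot_def)

lemma match_scan_range:
  assumes "(i, j) \<in> set (match_scan k st as)"
  shows "i \<in> set st \<union> {k..<k + length as} \<and> j \<in> {k..<k + length as}"
  using assms by (induction k st as rule: match_scan.induct) (fastforce split: if_splits list.splits)+

lemma Delta_closed:
  assumes "\<alpha> \<in> ballot n"
  shows "Delta n \<alpha> \<in> carrier (ext_ring n)"
proof -
  interpret ring "ext_ring n" by (rule ring_ext_ring)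
  have th: "theta i \<in> carrier (ext_ring n)" if "i \<in> {1..n}" for i
    using that by (auto simp: theta_def intro: theta_mon_closed)
  have "set (matching \<alpha>) \<subseteq> {1..n} \<times> {1..n}"
    using match_scan_range[of _ _ 1 "[]" \<alpha>] assms
    unfolding matching_def ballot_def by fastforce
  then have "foldr (mult (ext_ring n)) (map (\<lambda>(i, j). theta j \<ominus>\<^bsub>ext_ring n\<^esub> theta i) xs)
      \<one>\<^bsub>ext_ring n\<^esub> \<in> carrier (ext_ring n)" if "set xs \<subseteq> set (matching \<alpha>)" for xs
    using that
  proof (induction xs)
    case (Cons x xs)
    obtain i j where "x = (i, j)" by (cases x)
    moreover from this have "i \<in> {1..n}" "j \<in> {1..n}"
      using Cons.prems \<open>set (matching \<alpha>) \<subseteq> {1..n} \<times> {1..n}\<close> by auto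
    ultimately show ?case using Cons th[of i] th[of j] by simp
  qed simp
  then show ?thesis unfolding Delta_def by blast
qed

end

theory Submission
  imports Defs
begin

text \<open>
  Orthogonality: since \<open>F_r\<close> commutes with every homogeneous element up to sign, it suffices to see
  that \<open>\<langle>F_r \<theta>_C, \<Delta>\<rangle> = 0\<close> for all \<open>C\<close>. A monomial of \<open>\<Delta>\<close> picks exactly one element of each matched pair,
  so some pair is not met by \<open>C\<close>; take an innermost such pair \<open>(i, j)\<close>. All monomials \<open>\<theta>_S\<close> of \<open>\<Delta>\<close> with
  \<open>C \<subseteq> S\<close> have the same elements strictly between \<open>i\<close> and \<open>j\<close>, namely those of \<open>C\<close>, because matchings are
  noncrossing. Exchanging \<open>i\<close> and \<open>j\<close> in \<open>S\<close> therefore changes the two sorting signs in the same way,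
  and the sign in \<open>\<theta>_j - \<theta>_i\<close> makes the terms cancel in pairs.

  Independence: among the monomials of \<open>\<Delta>\<close> the one formed by the closing positions is the unique one
  with the largest sum of indices, and the closing positions determine the ballot sequence.
\<close>

section \<open>Products of differences of generators\<close>

text \<open>A list rather than a set, so that \<open>distinct\<close> makes the pairs disjoint and
  the two entries of each pair different.\<close>

definition pair_entries :: "(nat \<times> nat) list \<Rightarrow> nat list" where
  "pair_entries xs = concat (map (\<lambda>(i, j). [i, j]) xs)"

lemma pair_entries_simps [simp]:
  "pair_entries [] = []"
  "pair_entries ((i, j) # xs) = i # j # pair_entries xs"
  by (simp_all add: pair_entries_def)

lemma in_pair_entries_iff:
  "m \<in> set (pair_entries xs) \<longleftrightarrow> (\<exists>(i, j) \<in> set xs. m = i \<or> m = j)"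
  by (auto simp: pair_entries_def)

text \<open>The product \<open>Delta\<close> freed from the record \<open>ext_ring n\<close>: no
  ambient \<open>n\<close> and no carrier conditions enter the inductions over the list of
  pairs.\<close>

fun pair_prod :: "(nat \<times> nat) list \<Rightarrow> nat set \<Rightarrow> rat" where
  "pair_prod [] = theta_mon {}"
| "pair_prod ((i, j) # xs) = ext_mult (\<lambda>A. theta j A - theta i A) (pair_prod xs)"

section \<open>Signs from sorting a generator into a monomial\<close>

definition sort_sign :: "nat \<Rightarrow> nat set \<Rightarrow> rat" where
  "sort_sign a S = (- 1) ^ card {b \<in> S. b < a}"

text \<open>For \<open>a\<close> outside \<open>S\<close>, \<open>theta_a theta_S\<close> is
  \<open>sort_sign a S\<close> times the sorted monomial. For i < j outside \<open>S\<close>,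
  \<open>between_sign i j S\<close> is the factor by which this sign changes when
  \<open>theta_i\<close> is replaced by \<open>theta_j\<close>.\<close>

definition between_sign :: "nat \<Rightarrow> nat \<Rightarrow> nat set \<Rightarrow> rat" where
  "between_sign i j S = (- 1) ^ card {b \<in> S. i < b \<and> b < j}"

lemma between_sign_cases: "between_sign i j S = 1 \<or> between_sign i j S = - 1"
  by (simp add: between_sign_def minus_one_power_iff)

lemma crossings_singleton: "crossings {a} B = card {b \<in> B. b < a}"
proof -
  have "{(x, b). x \<in> {a} \<and> b \<in> B \<and> b < x} = Pair a ` {b \<in> B. b < a}" by auto
  then show ?thesis unfolding crossings_def by (simp add: card_image inj_on_def)
qed

lemma sort_sign_insert:
  assumes "finite S" "i \<notin> S"
  shows "sort_sign a (insert i S) = (if i < a then - sort_sign a S else sort_sign a S)"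
proof (cases "i < a")
  case True
  then have "{b \<in> insert i S. b < a} = insert i {b \<in> S. b < a}" by auto
  then show ?thesis using assms True by (simp add: sort_sign_def)
next
  case False
  then have "{b \<in> insert i S. b < a} = {b \<in> S. b < a}" by auto
  then show ?thesis using False by (simp add: sort_sign_def)
qed

lemma between_sign_insert:
  assumes "finite S" "c \<notin> S"
  shows "between_sign i j (insert c S) =
    (if i < c \<and> c < j then - between_sign i j S else between_sign i j S)"
proof (cases "i < c \<and> c < j")
  case True
  then have "{b \<in> insert c S. i < b \<and> b < j} = insert c {b \<in> S. i < b \<and> b < j}" by auto
  then show ?thesis using assms True by (simp add: between_sign_def)
next
  case False
  then have "{b \<in> insert c S. i < b \<and> b < j} = {b \<in> S. i < b \<and> b < j}" by auto
  then show ?thesis using False by (auto simp: between_sign_def)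
qed

lemma sort_sign_between:
  assumes "finite S" "i \<notin> S" "i < j"
  shows "sort_sign j S = between_sign i j S * sort_sign i S"
proof -
  have "{b \<in> S. b < j} = {b \<in> S. i < b \<and> b < j} \<union> {b \<in> S. b < i}"
    using assms by (auto intro: linorder_neqE_nat)
  moreover have "{b \<in> S. i < b \<and> b < j} \<inter> {b \<in> S. b < i} = {}" by auto
  ultimately have "card {b \<in> S. b < j} = card {b \<in> S. i < b \<and> b < j} + card {b \<in> S. b < i}"
    using assms by (simp add: card_Un_disjoint)
  then show ?thesis by (simp add: sort_sign_def between_sign_def power_add)
qed

section \<open>Coefficients and support of the product\<close>

lemma ext_mult_theta_coeff:
  assumes "finite S"
  shows "ext_mult (theta i) q S = (if i \<in> S then sort_sign i S * q (S - {i}) else 0)"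
proof -
  have "ext_mult (theta i) q S =
      (\<Sum>A\<in>Pow S. if A = {i} then (- 1) ^ crossings {i} (S - {i}) * q (S - {i}) else 0)"
    unfolding ext_mult_def theta_def theta_mon_def by (rule sum.cong) auto
  \<comment> \<open>\<open>i\<close> is not below itself, so removing it from \<open>S\<close>
    leaves the sign unchanged.\<close>
  moreover have "{b \<in> S - {i}. b < i} = {b \<in> S. b < i}" by auto
  ultimately show ?thesis using assms by (simp add: crossings_singleton sort_sign_def)
qed

lemma pair_prod_Cons_coeff:
  assumes "finite S"
  shows "pair_prod ((i, j) # xs) S =
    (if j \<in> S then sort_sign j S * pair_prod xs (S - {j}) else 0) -
    (if i \<in> S then sort_sign i S * pair_prod xs (S - {i}) else 0)"
proof -
  have "pair_prod ((i, j) # xs) S =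
      ext_mult (theta j) (pair_prod xs) S - ext_mult (theta i) (pair_prod xs) S"
    by (simp add: ext_mult_def algebra_simps sum_subtractf)
  then show ?thesis by (simp only: ext_mult_theta_coeff[OF assms])
qed

text \<open>The sum over an infinite \<open>Pow S\<close> is 0 by convention. Hence a nonzero
  coefficient always forces \<open>S\<close> to be finite.\<close>

lemma pair_prod_infinite: "infinite S \<Longrightarrow> pair_prod xs S = 0"
  by (cases xs) (auto simp: theta_mon_def ext_mult_infinite)

lemma pair_prod_Cons_nonzeroE:
  assumes "pair_prod ((i, j) # xs) S \<noteq> 0"
  obtains a where "a = i \<or> a = j" "a \<in> S" "pair_prod xs (S - {a}) \<noteq> 0"
proof -
  have "finite S" using assms pair_prod_infinite by blast
  from assms[unfolded pair_prod_Cons_coeff[OF this]] that show thesis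
    by (cases "j \<in> S \<and> pair_prod xs (S - {j}) \<noteq> 0") (auto split: if_splits)
qed

text \<open>Expanding the product picks one generator from each factor, and distinctness keeps the
  choices for different pairs independent.\<close>

lemma pair_prod_support:
  assumes "pair_prod xs S \<noteq> 0" "distinct (pair_entries xs)"
  shows "S \<subseteq> set (pair_entries xs) \<and> (\<forall>(i, j) \<in> set xs. (i \<in> S) \<noteq> (j \<in> S))"
  using assms
proof (induction xs arbitrary: S)
  case Nil
  then show ?case by (auto simp: theta_mon_def split: if_splits)
next
  case (Cons x xs)
  obtain i j where x: "x = (i, j)" by (cases x)
  from Cons.prems(1) obtain a where a: "a = i \<or> a = j" "a \<in> S" "pair_prod xs (S - {a}) \<noteq> 0"
    unfolding x by (rule pair_prod_Cons_nonzeroE)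
  have d: "distinct (pair_entries xs)" "i \<noteq> j" "i \<notin> set (pair_entries xs)" "j \<notin> set (pair_entries xs)"
    using Cons.prems(2) by (auto simp: x)
  note IH = Cons.IH[OF a(3) d(1)]
  \<comment> \<open>Hence removing \<open>a\<close> from \<open>S\<close> does not affect which
    entries of the remaining pairs belong to it.\<close>
  have "a \<notin> set (pair_entries xs)" using a d by auto
  then have "(k \<in> S) \<noteq> (l \<in> S)" if "(k, l) \<in> set xs" for k l
    using that IH in_pair_entries_iff[of a xs] by fastforce
  moreover have "(i \<in> S) \<noteq> (j \<in> S)" using IH a d by auto
  ultimately show ?case using IH a by (auto simp: x)
qed

lemma pair_prod_support_exactly_one:
  assumes "pair_prod xs S \<noteq> 0" "distinct (pair_entries xs)" "(i, j) \<in> set xs"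
  shows "i \<in> S \<longleftrightarrow> j \<notin> S"
  using pair_prod_support[OF assms(1,2)] assms(3) by auto

text \<open>The two monomials differ only in the choice from the factor
  \<open>theta_j - theta_i\<close>. The minus sign comes from that factor,
  \<open>between_sign\<close> from sorting.\<close>

lemma pair_prod_swap:
  assumes "distinct (pair_entries xs)" "(i, j) \<in> set xs" "i < j" "finite S" "i \<notin> S" "j \<notin> S"
  shows "pair_prod xs (insert j S) = - between_sign i j S * pair_prod xs (insert i S)"
  using assms
proof (induction xs arbitrary: S)
  case (Cons x xs)
  obtain a b where x: "x = (a, b)" by (cases x)
  note fin = Cons.prems(4)
  have finI: "finite (insert j S)" "finite (insert i S)" using fin by auto
  show ?case
  proof (cases "x = (i, j)")
    case True
    \<comment> \<open>As \<open>S\<close> contains neither \<open>i\<close> nor \<open>j\<close>,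
      each side keeps a single term of the recurrence, both with the coefficient of
      \<open>xs\<close> at \<open>S\<close>.\<close>
    have "insert j S - {j} = S" "insert i S - {i} = S" using Cons.prems by auto
    then show ?thesis
      using Cons.prems fin unfolding True
      by (simp add: pair_prod_Cons_coeff[OF finI(1)] pair_prod_Cons_coeff[OF finI(2)]
          sort_sign_insert sort_sign_between[of S i j] del: pair_prod.simps)
  next
    case False
    then have mem: "(i, j) \<in> set xs" using Cons.prems by auto
    then have "i \<in> set (pair_entries xs)" "j \<in> set (pair_entries xs)"
      by (auto simp: in_pair_entries_iff)
    then have ne: "a \<noteq> i" "a \<noteq> j" "b \<noteq> i" "b \<noteq> j" using Cons.prems(1) by (auto simp: x)
    \<comment> \<open>A choice \<open>c\<close> from another factor is compatible with the exchange:
      if \<open>c\<close> lies between \<open>i\<close> and \<open>j\<close>, the sorting sign of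
      \<open>c\<close> sees \<open>i\<close> but not \<open>j\<close>, and
      \<open>between_sign\<close> flips as well when \<open>c\<close> is removed; otherwise nothing
      changes.\<close>
    have term_swap: "(if c \<in> insert j S then sort_sign c (insert j S) * pair_prod xs (insert j S - {c}) else 0) =
        - between_sign i j S *
        (if c \<in> insert i S then sort_sign c (insert i S) * pair_prod xs (insert i S - {c}) else 0)"
      if "c \<noteq> i" "c \<noteq> j" for c
    proof (cases "c \<in> S")
      case True
      define S0 where "S0 = S - {c}"
      have S0: "S = insert c S0" "c \<notin> S0" "finite S0" "i \<notin> S0" "j \<notin> S0"
        using True fin Cons.prems by (auto simp: S0_def)
      have e: "insert j S - {c} = insert j S0" "insert i S - {c} = insert i S0"
        using that by (auto simp: S0_def)
      have "pair_prod xs (insert j S0) = - between_sign i j S0 * pair_prod xs (insert i S0)"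
        using Cons.prems mem S0 by (intro Cons.IH) (auto simp: x)
      then show ?thesis
        using True S0 that Cons.prems fin \<open>i < j\<close> unfolding e
        by (auto simp: sort_sign_insert between_sign_insert)
    qed (use that in auto)
    show ?thesis
      unfolding x pair_prod_Cons_coeff[OF finI(1)] pair_prod_Cons_coeff[OF finI(2)]
        term_swap[OF ne(1,2)] term_swap[OF ne(3,4)]
      by (simp add: algebra_simps)
  qed
qed simp

text \<open>A first entry of a pair is never a second entry of another one, so the recurrence
  retains one term at each factor and nothing can cancel.\<close>

lemma pair_prod_leading_coeff:
  assumes "distinct (pair_entries xs)"
  shows "pair_prod xs (set (map snd xs)) \<noteq> 0"
  using assms
proof (induction xs)
  case (Cons x xs)
  obtain i j where x: "x = (i, j)" by (cases x)
  have sub: "set (map snd xs) \<subseteq> set (pair_entries xs)" by (force simp: in_pair_entries_iff)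
  then have "i \<notin> set (map snd (x # xs))" "insert j (set (map snd xs)) - {j} = set (map snd xs)"
    using Cons.prems by (auto simp: x)
  then show ?case
    using Cons by (simp add: x pair_prod_Cons_coeff sort_sign_def del: pair_prod.simps)
qed (simp add: theta_mon_def)

text \<open>Choosing \<open>i\<close> instead of \<open>j\<close> from a factor strictly lowers the
  index sum, so the maximum is reached only by choosing every second entry.\<close>

lemma pair_prod_sum_le:
  assumes "pair_prod xs S \<noteq> 0" "distinct (pair_entries xs)" "\<forall>(i, j) \<in> set xs. i < j"
  shows "\<Sum>S \<le> \<Sum>(set (map snd xs)) \<and> (\<Sum>S = \<Sum>(set (map snd xs)) \<longrightarrow> S = set (map snd xs))"
  using assms
proof (induction xs arbitrary: S)
  case Nil
  then show ?case by (auto simp: theta_mon_def split: if_splits)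
next
  case (Cons x xs)
  obtain i j where x: "x = (i, j)" by (cases x)
  from Cons.prems(1) obtain a where a: "a = i \<or> a = j" "a \<in> S" "pair_prod xs (S - {a}) \<noteq> 0"
    unfolding x by (rule pair_prod_Cons_nonzeroE)
  have "set (map snd xs) \<subseteq> set (pair_entries xs)" by (force simp: in_pair_entries_iff)
  then have j: "j \<notin> set (map snd xs)" using Cons.prems(2) by (auto simp: x)
  have IH: "\<Sum>(S - {a}) \<le> \<Sum>(set (map snd xs)) \<and>
      (\<Sum>(S - {a}) = \<Sum>(set (map snd xs)) \<longrightarrow> S - {a} = set (map snd xs))"
    using Cons.prems a(3) by (intro Cons.IH) (auto simp: x)
  have "finite S" using Cons.prems(1) pair_prod_infinite by blast
  then have s1: "\<Sum>S = a + \<Sum>(S - {a})" using a(2) by (simp add: sum.remove)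
  have s2: "\<Sum>(set (map snd (x # xs))) = j + \<Sum>(set (map snd xs))" using j by (simp add: x)
  have ij: "a \<le> j" "i < j" using a(1) Cons.prems(3) by (auto simp: x)
  have "S = set (map snd (x # xs))" if "\<Sum>S = \<Sum>(set (map snd (x # xs)))"
  proof -
    \<comment> \<open>Both parts of the sum are bounded separately, so equality of the totals forces
      equality in each.\<close>
    have "a = j" "S - {a} = set (map snd xs)" using that IH s1 s2 ij by linarith+
    then show ?thesis using a(2) by (auto simp: x)
  qed
  then show ?case using IH s1 s2 ij by linarith
qed

section \<open>Orthogonality to the ideal\<close>

text \<open>More than the absence of crossings: no unmatched position may lie inside a pair either.
  Thus every position inside a pair belongs to a shorter pair nested in it.\<close>

definition noncrossing :: "(nat \<times> nat) list \<Rightarrow> bool" where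
  "noncrossing xs \<longleftrightarrow> (\<forall>(i, j) \<in> set xs. i < j \<and> (\<forall>m. i < m \<and> m < j \<longrightarrow>
     (\<exists>(i', j') \<in> set xs. (m = i' \<or> m = j') \<and> i < i' \<and> j' < j)))"

text \<open>Reindexing along \<open>f\<close> equates the sum with its own negative. Fixed points of
  \<open>f\<close> are allowed; the last assumption gives them weight 0.\<close>

lemma sum_involution_neg:
  fixes w :: "'a \<Rightarrow> rat"
  assumes "\<And>x. x \<in> X \<Longrightarrow> f x \<in> X" "\<And>x. x \<in> X \<Longrightarrow> f (f x) = x" "\<And>x. x \<in> X \<Longrightarrow> w (f x) = - w x"
  shows "sum w X = 0"
proof -
  have "sum w X = (\<Sum>x\<in>X. - w x)"
    by (rule sum.reindex_bij_witness[of _ f f]) (use assms in auto)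
  then show ?thesis by (simp add: sum_negf)
qed

text \<open>The exchange multiplies the sign of sorting past \<open>C\<close> by
  \<open>between_sign i j C\<close> and the coefficient by
  \<open>- between_sign i j (A \<union> C)\<close>. By minimality of the pair these two
  between-signs agree whenever the coefficient is nonzero, so their product is -1.\<close>

lemma innermost_swap:
  assumes "distinct (pair_entries xs)" "noncrossing xs" "finite A" "finite C"
    and "(i, j) \<in> set xs" "i \<notin> A" "j \<notin> A" "i \<notin> C" "j \<notin> C" "A \<inter> C = {}"
    and min: "\<And>k l. (k, l) \<in> set xs \<Longrightarrow> k \<notin> C \<Longrightarrow> l \<notin> C \<Longrightarrow> j - i \<le> l - k"
  shows "(- 1) ^ crossings (insert j A) C * pair_prod xs (insert j A \<union> C) =
    - ((- 1) ^ crossings (insert i A) C * pair_prod xs (insert i A \<union> C))"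
proof -
  have "i < j" using assms by (auto simp: noncrossing_def)
  have cr: "(- 1) ^ crossings (insert a A) C = sort_sign a C * (- 1) ^ crossings A C"
    if "a \<notin> A" for a
    using crossings_Un_left[of "{a}" A C] that assms
    by (simp add: crossings_singleton sort_sign_def power_add)
  have swap: "pair_prod xs (insert j (A \<union> C)) =
      - between_sign i j (A \<union> C) * pair_prod xs (insert i (A \<union> C))"
    using pair_prod_swap[of xs i j "A \<union> C"] assms \<open>i < j\<close> by simp
  show ?thesis
  proof (cases "pair_prod xs (insert i A \<union> C) = 0")
    case False
    \<comment> \<open>Such a \<open>b\<close> lies in a nested, hence shorter pair, which meets
      \<open>C\<close> by minimality. Only one entry of that pair is in the support, so it must be
      \<open>b\<close>, and elements of \<open>A\<close> contribute nothing new between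
      \<open>i\<close> and \<open>j\<close>.\<close>
    have "b \<in> C" if b: "b \<in> A" "i < b" "b < j" for b
    proof -
      obtain k l where kl: "(k, l) \<in> set xs" "b = k \<or> b = l" "i < k" "l < j"
        using assms(2,5) b unfolding noncrossing_def by blast
      moreover have "k < l" using assms(2) kl(1) by (auto simp: noncrossing_def)
      ultimately have "\<not> j - i \<le> l - k" by linarith
      then have "k \<in> C \<or> l \<in> C" using min kl(1) by blast
      moreover have "k \<in> insert i A \<union> C \<longleftrightarrow> l \<notin> insert i A \<union> C"
        using pair_prod_support_exactly_one[OF False assms(1) kl(1)] .
      ultimately show ?thesis using kl(2) b(1) by auto
    qed
    then have "{b \<in> A \<union> C. i < b \<and> b < j} = {b \<in> C. i < b \<and> b < j}" by auto
    then have "between_sign i j (A \<union> C) = between_sign i j C" by (simp add: between_sign_def)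
    then show ?thesis
      using assms \<open>i < j\<close> between_sign_cases[of i j C]
      by (auto simp: swap cr sort_sign_between[of C i j])
  qed (simp add: swap)
qed

text \<open>For \<open>C \<subseteq> U = {1..n}\<close> the left side is the inner product of
  \<open>F_r theta_C\<close> with the product. Either \<open>C\<close> meets every pair and each
  term vanishes, or exchanging the entries of a shortest unmet pair cancels the terms.\<close>

lemma sum_pair_prod_extensions:
  assumes "distinct (pair_entries xs)" "noncrossing xs" "set (pair_entries xs) \<subseteq> U"
    and "finite U" "finite C" "r \<ge> 1"
  shows "(\<Sum>A | A \<subseteq> U - C \<and> card A = r. (- 1) ^ crossings A C * pair_prod xs (A \<union> C)) = 0"
proof (cases "\<exists>(i, j) \<in> set xs. i \<notin> C \<and> j \<notin> C")
  case False
  have "pair_prod xs (A \<union> C) = 0" if A: "A \<subseteq> U - C" "card A = r" for A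
  proof (rule ccontr)
    assume "pair_prod xs (A \<union> C) \<noteq> 0"
    note supp = pair_prod_support[OF this assms(1)]
    \<comment> \<open>Here r \<ge> 1 enters: \<open>a\<close> is an entry of a pair that
      \<open>C\<close> already meets, so \<open>A \<union> C\<close> would contain both
      entries.\<close>
    obtain a where a: "a \<in> A" using A assms(6) by fastforce
    then have "a \<in> set (pair_entries xs)" using supp by auto
    then obtain k l where kl: "(k, l) \<in> set xs" "a = k \<or> a = l" by (auto simp: in_pair_entries_iff)
    have "(k \<in> A \<union> C) \<noteq> (l \<in> A \<union> C)" using supp kl(1) by blast
    then show False using False kl a A(1) by blast
  qed
  then show ?thesis by (intro sum.neutral) auto
next
  case True
  define Q where "Q = (\<lambda>p. p \<in> set xs \<and> fst p \<notin> C \<and> snd p \<notin> C)"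
  obtain p where "Q p" "\<And>p'. Q p' \<Longrightarrow> snd p - fst p \<le> snd p' - fst p'"
    using ex_has_least_nat[of Q _ "\<lambda>p. snd p - fst p"] True unfolding Q_def by force
  moreover obtain i j where "p = (i, j)" by (cases p)
  ultimately have ij: "(i, j) \<in> set xs" "i \<notin> C" "j \<notin> C"
    and min: "\<And>k l. (k, l) \<in> set xs \<Longrightarrow> k \<notin> C \<Longrightarrow> l \<notin> C \<Longrightarrow> j - i \<le> l - k"
    unfolding Q_def by force+
  have "i < j" using assms(2) ij by (auto simp: noncrossing_def)
  have "i \<in> set (pair_entries xs)" "j \<in> set (pair_entries xs)"
    using ij(1) by (auto simp: in_pair_entries_iff)
  then have ijU: "i \<in> U" "j \<in> U" using assms(3) by auto
  \<comment> \<open>Exchanges \<open>i\<close> and \<open>j\<close> when \<open>A\<close> contains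
    exactly one of them. The fixed sets contain both or neither, so their terms vanish by the
    support condition.\<close>
  define f where "f A = (if i \<in> A \<and> j \<notin> A then insert j (A - {i})
    else if j \<in> A \<and> i \<notin> A then insert i (A - {j}) else A)" for A
  have swap: "(- 1) ^ crossings (insert j A) C * pair_prod xs (insert j A \<union> C) =
      - ((- 1) ^ crossings (insert i A) C * pair_prod xs (insert i A \<union> C))"
    if "A \<subseteq> U - C" "i \<notin> A" "j \<notin> A" for A
    using that assms ij min by (intro innermost_swap) (auto intro: finite_subset)
  show ?thesis
  proof (rule sum_involution_neg[where f = f], goal_cases)
    case (1 A)
    have "finite A" using 1 assms(4) by (auto intro: finite_subset)
    then have "card (insert l (A - {k})) = card A" if "k \<in> A" "l \<notin> A" for k l
      using that by (metis Diff_iff card_Suc_Diff1 card_insert_disjoint finite_Diff)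
    then have "card (f A) = card A" by (simp add: f_def)
    then show ?case using 1 ij ijU unfolding f_def by auto
  next
    case (2 A)
    show ?case using \<open>i < j\<close> unfolding f_def by auto
  next
    case (3 A)
    then have A: "A \<subseteq> U - C" by auto
    consider "i \<in> A" "j \<notin> A" | "j \<in> A" "i \<notin> A" | "(i \<in> A) = (j \<in> A)" by blast
    then show ?case
    proof cases
      case 1
      then have "insert i (A - {i}) = A" "f A = insert j (A - {i})" unfolding f_def by auto
      moreover have "A - {i} \<subseteq> U - C" using A by auto
      ultimately show ?thesis using swap[of "A - {i}"] 1 by simp
    next
      case 2
      then have "insert j (A - {j}) = A" "f A = insert i (A - {j})" unfolding f_def by auto
      moreover have "A - {j} \<subseteq> U - C" using A by auto
      ultimately show ?thesis using swap[of "A - {j}"] 2 by simp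
    next
      case 3
      have "pair_prod xs (A \<union> C) = 0"
        using pair_prod_support_exactly_one[OF _ assms(1) ij(1), of "A \<union> C"] ij 3 by blast
      moreover have "f A = A" using 3 by (auto simp: f_def)
      ultimately show ?thesis by simp
    qed
  qed
qed

section \<open>Moving \<open>F_r\<close> past arbitrary elements and expanding its multiples\<close>

lemma F_ones_coeff:
  "F_ones n r = (\<lambda>B. if B \<subseteq> {1..n} \<and> card B = r then 1 else 0)"
proof -
  have fin: "finite {A. A \<subseteq> {1..n} \<and> card A = r}" by simp
  have "F_ones n r = (\<lambda>B. \<Sum>A | A \<subseteq> {1..n} \<and> card A = r. theta_mon A B)"
    unfolding F_ones_def by (rule finsum_ext_ring[OF fin]) (auto intro!: theta_mon_closed)
  then show ?thesis using fin by (auto simp: theta_mon_def)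
qed

lemma F_ones_closed: "F_ones n r \<in> carrier (ext_ring n)"
  by (auto simp: F_ones_coeff ext_ring_def)

text \<open>Each element of \<open>A \<times> B\<close> is counted by exactly one of the two
  numbers, since disjointness excludes ties.\<close>

lemma crossings_swap:
  assumes "finite A" "finite B" "A \<inter> B = {}"
  shows "crossings A B + crossings B A = card A * card B"
proof -
  have "crossings B A = card {(a, b). a \<in> A \<and> b \<in> B \<and> a < b}"
    unfolding crossings_def
    by (rule bij_betw_same_card[of prod.swap]) (auto simp: bij_betw_def inj_on_def image_iff)
  moreover have "card {(a, b). a \<in> A \<and> b \<in> B \<and> b < a} + card {(a, b). a \<in> A \<and> b \<in> B \<and> a < b} =
      card ({(a, b). a \<in> A \<and> b \<in> B \<and> b < a} \<union> {(a, b). a \<in> A \<and> b \<in> B \<and> a < b})"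
  proof (rule card_Un_disjoint[symmetric])
    show "finite {(a, b). a \<in> A \<and> b \<in> B \<and> b < a}" "finite {(a, b). a \<in> A \<and> b \<in> B \<and> a < b}"
      by (rule finite_subset[of _ "A \<times> B"]; use assms in auto)+
  qed auto
  moreover have "{(a, b). a \<in> A \<and> b \<in> B \<and> b < a} \<union> {(a, b). a \<in> A \<and> b \<in> B \<and> a < b} = A \<times> B"
    using assms(3) by (auto intro: linorder_neqE_nat)
  ultimately show ?thesis
    by (simp add: crossings_def card_cartesian_product)
qed

text \<open>Graded commutativity with an element of degree \<open>r\<close>, where the sign is
  absorbed into each coefficient of \<open>a\<close>; this way \<open>a\<close> may be
  inhomogeneous.\<close>

lemma F_ones_commute:
  "ext_mult a (F_ones n r) = ext_mult (F_ones n r) (\<lambda>A. (- 1) ^ (r * card A) * a A)"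
proof
  fix S
  show "ext_mult a (F_ones n r) S = ext_mult (F_ones n r) (\<lambda>A. (- 1) ^ (r * card A) * a A) S"
  proof (cases "finite S")
    case True
    show ?thesis
      unfolding ext_mult_def
    \<comment> \<open>Complementation in \<open>S\<close> interchanges the index sets of the two
      factors.\<close>
    proof (rule sum.reindex_bij_witness[of _ "\<lambda>A. S - A" "\<lambda>A. S - A"], goal_cases)
      case (5 A)
      then have A: "A \<subseteq> S" "S - (S - A) = A" by auto
      have fin: "finite A" using A True by (auto intro: finite_subset)
      show ?case
      proof (cases "S - A \<subseteq> {1..n} \<and> card (S - A) = r")
        case 1: True
        have "crossings A (S - A) + crossings (S - A) A = r * card A"
          using crossings_swap[of A "S - A"] fin True 1 by (auto simp: mult.commute)
        then have "(- 1 :: rat) ^ (r * card A) = (- 1) ^ crossings A (S - A) * (- 1) ^ crossings (S - A) A"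
          by (metis power_add)
        then show ?thesis
          using A 1 by (simp add: F_ones_coeff mult_ac flip: power_add) (simp add: power_add)
      qed (auto simp: F_ones_coeff A(2))
    qed auto
  qed (simp add: ext_mult_infinite)
qed

lemma inner_F_ones_mult:
  assumes "distinct (pair_entries xs)" "noncrossing xs" "set (pair_entries xs) \<subseteq> {1..n}" "r \<ge> 1"
  shows "(\<Sum>S\<in>Pow {1..n}. ext_mult (F_ones n r) b S * pair_prod xs S) = 0"
proof -
  let ?w = "\<lambda>A C. (- 1) ^ crossings A C * pair_prod xs (A \<union> C)"
  let ?X = "\<lambda>C. {A. A \<subseteq> {1..n} - C \<and> card A = r}"
  have "(\<Sum>S\<in>Pow {1..n}. ext_mult (F_ones n r) b S * pair_prod xs S) =
      (\<Sum>S\<in>Pow {1..n}. \<Sum>A | A \<subseteq> S \<and> card A = r. b (S - A) * ((- 1) ^ crossings A (S - A) * pair_prod xs S))"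
  proof (rule sum.cong[OF refl])
    fix S assume S: "S \<in> Pow {1..n}"
    then have "finite S" by (auto intro: finite_subset)
    then have "ext_mult (F_ones n r) b S = (\<Sum>A | A \<subseteq> S \<and> card A = r. b (S - A) * (- 1) ^ crossings A (S - A))"
      unfolding ext_mult_def F_ones_coeff using S
      by (intro sum.mono_neutral_cong_right) auto
    then show "ext_mult (F_ones n r) b S * pair_prod xs S =
        (\<Sum>A | A \<subseteq> S \<and> card A = r. b (S - A) * ((- 1) ^ crossings A (S - A) * pair_prod xs S))"
      by (simp add: sum_distrib_right mult.assoc)
  qed
  also have "\<dots> = (\<Sum>(S, A)\<in>Sigma (Pow {1..n}) (\<lambda>S. {A. A \<subseteq> S \<and> card A = r}).
      b (S - A) * ((- 1) ^ crossings A (S - A) * pair_prod xs S))"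
    by (rule sum.Sigma) (auto intro!: finite_subset[of _ "Pow {1..n}"])
  \<comment> \<open>The set \<open>C = S - A\<close> indexes the monomial taken from
    \<open>b\<close>; fixing it first isolates the vanishing sum over \<open>A\<close>.\<close>
  also have "\<dots> = (\<Sum>(C, A)\<in>Sigma (Pow {1..n}) ?X. b C * ?w A C)"
  proof (rule sum.reindex_bij_witness[where i = "\<lambda>(C, A). (A \<union> C, A)" and j = "\<lambda>(S, A). (S - A, A)"],
      goal_cases)
    case (5 x)
    then have "snd x \<union> (fst x - snd x) = fst x" by auto
    then show ?case by (simp add: case_prod_beta)
  qed auto
  also have "\<dots> = (\<Sum>C\<in>Pow {1..n}. \<Sum>A\<in>?X C. b C * ?w A C)"
    by (rule sum.Sigma[symmetric]) auto
  also have "\<dots> = (\<Sum>C\<in>Pow {1..n}. b C * (\<Sum>A\<in>?X C. ?w A C))"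
    by (simp add: sum_distrib_left)
  also have "\<dots> = 0"
    using sum_pair_prod_extensions[OF assms(1-3) _ _ assms(4)]
    by (intro sum.neutral ballI) (auto intro: finite_subset)
  finally show ?thesis .
qed

lemma ideal_orthogonal:
  fixes q :: "nat set \<Rightarrow> rat"
  assumes "\<And>r b. r \<in> {1..n} \<Longrightarrow> (\<Sum>S\<in>Pow {1..n}. ext_mult (F_ones n r) b S * q S) = 0"
    and "p \<in> I_ideal n"
  shows "(\<Sum>S\<in>Pow {1..n}. p S * q S) = 0"
proof -
  interpret ring "ext_ring n" by (rule ring_ext_ring)
  let ?R = "carrier (ext_ring n)"
  let ?ip = "\<lambda>p. \<Sum>S\<in>Pow {1..n}. p S * q S"
  have mult_eq: "mult (ext_ring n) = ext_mult" and add_eq: "add (ext_ring n) = (\<lambda>p q A. p A + q A)"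
    by (simp_all add: ext_ring_def)
  have ip_add: "?ip (add (ext_ring n) u v) = ?ip u + ?ip v" for u v
    by (simp add: add_eq sum.distrib algebra_simps)
  \<comment> \<open>Orthogonality to \<open>q\<close> alone is not stable under multiplication;
    requiring it for all \<open>a p b\<close> yields a two-sided ideal, and \<open>a = b = 1\<close>
    recovers orthogonality of \<open>p\<close>.\<close>
  define J where "J = {p \<in> ?R. \<forall>a \<in> ?R. \<forall>b \<in> ?R. ?ip (a \<otimes>\<^bsub>ext_ring n\<^esub> p \<otimes>\<^bsub>ext_ring n\<^esub> b) = 0}"
  have zero: "\<zero>\<^bsub>ext_ring n\<^esub> = (\<lambda>A. 0)" by (simp add: ext_ring_def)
  have "ideal J (ext_ring n)"
  proof (rule idealI[OF ring_ext_ring])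
    show "subgroup J (add_monoid (ext_ring n))"
    proof (rule add.subgroupI)
      show "J \<subseteq> ?R" by (auto simp: J_def)
      have "\<zero>\<^bsub>ext_ring n\<^esub> \<in> J" by (simp add: J_def) (simp add: zero)
      then show "J \<noteq> {}" by auto
    next
      fix u assume u: "u \<in> J"
      have "?ip (a \<otimes>\<^bsub>ext_ring n\<^esub> (\<ominus>\<^bsub>ext_ring n\<^esub> u) \<otimes>\<^bsub>ext_ring n\<^esub> b) = 0" if "a \<in> ?R" "b \<in> ?R" for a b
      proof -
        have uR: "u \<in> ?R" and z: "?ip (a \<otimes>\<^bsub>ext_ring n\<^esub> u \<otimes>\<^bsub>ext_ring n\<^esub> b) = 0"
          using u that by (auto simp: J_def)
        have "?ip (a \<otimes>\<^bsub>ext_ring n\<^esub> (\<ominus>\<^bsub>ext_ring n\<^esub> u) \<otimes>\<^bsub>ext_ring n\<^esub> b) + ?ip (a \<otimes>\<^bsub>ext_ring n\<^esub> u \<otimes>\<^bsub>ext_ring n\<^esub> b) =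
            ?ip (\<zero>\<^bsub>ext_ring n\<^esub>)"
          using that uR by (subst ip_add[symmetric]) (simp add: l_minus r_minus l_neg)
        then show ?thesis using z by (simp add: zero)
      qed
      then show "\<ominus>\<^bsub>ext_ring n\<^esub> u \<in> J" using u by (auto simp: J_def)
    next
      fix u v assume "u \<in> J" "v \<in> J"
      then show "u \<oplus>\<^bsub>ext_ring n\<^esub> v \<in> J"
        unfolding J_def by (simp add: l_distr r_distr ip_add del: atLeastAtMost_iff One_nat_def)
    qed
  next
    fix u x assume "u \<in> J" "x \<in> ?R"
    then show "x \<otimes>\<^bsub>ext_ring n\<^esub> u \<in> J" "u \<otimes>\<^bsub>ext_ring n\<^esub> x \<in> J"
      unfolding J_def by (auto simp: m_assoc[symmetric]) (simp add: m_assoc)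
  qed
  \<comment> \<open>Moving \<open>F_r\<close> to the front turns every two-sided multiple into a
    right multiple, the only kind covered by the assumption.\<close>
  moreover have "ext_mult (ext_mult a (F_ones n r)) b =
      ext_mult (F_ones n r) (ext_mult (\<lambda>A. (- 1) ^ (r * card A) * a A) b)" for a b r
    by (simp only: F_ones_commute[of a] ext_mult_assoc)
  then have "F_ones n ` {1..n} \<subseteq> J"
    using assms(1) F_ones_closed unfolding J_def mult_eq by auto
  ultimately have "I_ideal n \<subseteq> J" unfolding I_ideal_def by (rule genideal_minimal)
  then have "p \<in> J" using assms(2) by auto
  then have "?ip (\<one>\<^bsub>ext_ring n\<^esub> \<otimes>\<^bsub>ext_ring n\<^esub> p \<otimes>\<^bsub>ext_ring n\<^esub> \<one>\<^bsub>ext_ring n\<^esub>) = 0" "p \<in> ?R"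
    unfolding J_def by blast+
  then show ?thesis by simp
qed

section \<open>The matching of a ballot sequence\<close>

lemma match_scan_entries:
  "set (pair_entries (match_scan k st as)) \<subseteq> set st \<union> {k..<k + length as}"
  using match_scan_range by (fastforce simp: in_pair_entries_iff)

text \<open>Later entries come from the remaining stack or from unread positions, so neither the
  popped position nor the current one can return.\<close>

lemma match_scan_distinct:
  assumes "distinct st" "\<forall>s \<in> set st. s < k"
  shows "distinct (pair_entries (match_scan k st as))"
  using assms
proof (induction k st as rule: match_scan.induct)
  case (2 k st a as)
  show ?case
  proof (cases "a = 0 \<or> st = []")
    case True
    then show ?thesis using 2 by (auto split: list.splits simp: less_Suc_eq)
  next
    case False
    then obtain i st' where st: "st = i # st'" by (cases st) auto
    have "distinct (pair_entries (match_scan (Suc k) st' as))"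
      using 2 False st by (auto simp: less_Suc_eq)
    then show ?thesis
      using False st 2(4,5) match_scan_entries[of "Suc k" st' as] by auto
  qed
qed simp

text \<open>In the next lemma \<open>P\<close> is the set of pairs emitted before position \<open>k\<close>.\<close>

lemma match_scan_noncrossing:
  assumes "sorted_wrt (>) st" "\<forall>s \<in> set st. s < k"
    and "\<And>s m. \<lbrakk>s \<in> set st; s < m; m < k; m \<notin> set st\<rbrakk> \<Longrightarrow>
      \<exists>(i', j') \<in> P. (m = i' \<or> m = j') \<and> s < i' \<and> j' < k"
    and "(i, j) \<in> set (match_scan k st as)"
  shows "i < j \<and> (\<forall>m. i < m \<and> m < j \<longrightarrow>
    (\<exists>(i', j') \<in> P \<union> set (match_scan k st as). (m = i' \<or> m = j') \<and> i < i' \<and> j' < j))"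
  using assms
proof (induction k st as arbitrary: P rule: match_scan.induct)
  case (2 k st a as)
  consider "a = 0" | "a \<noteq> 0" "st = []" | s st' where "a \<noteq> 0" "st = s # st'" by (cases st) auto
  then show ?case
  proof cases
    case 1
    \<comment> \<open>Nothing lies strictly between \<open>k\<close> and \<open>Suc k\<close>, and
      \<open>k\<close> itself is now on the stack, so only the old stack positions matter.\<close>
    have "\<exists>(i', j') \<in> P. (m = i' \<or> m = j') \<and> s < i' \<and> j' < Suc k"
      if "s \<in> set (k # st)" "s < m" "m < Suc k" "m \<notin> set (k # st)" for s m
    proof -
      have "s \<in> set st" "m < k" "m \<notin> set st" using that by auto
      then obtain i' j' where "(i', j') \<in> P" "m = i' \<or> m = j'" "s < i'" "j' < k"
        using 2(6)[of s m] \<open>s < m\<close> by auto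
      then show ?thesis by (intro bexI[of _ "(i', j')"]) auto
    qed
    moreover have "(i, j) \<in> set (match_scan (Suc k) (k # st) as)" using 2(7) 1 by simp
    moreover have "sorted_wrt (>) (k # st)" "\<forall>s \<in> set (k # st). s < Suc k" using 2(4,5) by auto
    ultimately show ?thesis using 2(1)[OF 1, of P] 1 by simp
  next
    case 2
    \<comment> \<open>A closing parenthesis is skipped only on an empty stack, where the invariant
      is vacuous.\<close>
    then show ?thesis using "2.IH"(2)[of P] "2.prems" by simp
  next
    case (3 s st')
    note st = 3
    let ?P = "insert (s, k) P"
    have scan: "match_scan k st (a # as) = (s, k) # match_scan (Suc k) st' as"
      using st by simp
    \<comment> \<open>The stack is decreasing, so the pair \<open>(s, k)\<close> lies to the right
      of every remaining \<open>t\<close> and serves as witness for both of its own entries.\<close>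
    have pre: "\<exists>(i', j') \<in> ?P. (m = i' \<or> m = j') \<and> t < i' \<and> j' < Suc k"
      if "t \<in> set st'" "t < m" "m < Suc k" "m \<notin> set st'" for t m
    proof (cases "m = k \<or> m = s")
      case True
      then show ?thesis using that(1) 2(4) st by auto
    next
      case False
      then have "t \<in> set st" "m < k" "m \<notin> set st" using that st by auto
      then obtain i' j' where "(i', j') \<in> P" "m = i' \<or> m = j'" "t < i'" "j' < k"
        using 2(6)[of t m] \<open>t < m\<close> by auto
      then show ?thesis by (intro bexI[of _ "(i', j')"]) auto
    qed
    have srt: "sorted_wrt (>) st'" "\<forall>t \<in> set st'. t < Suc k" using 2(4,5) st by auto
    show ?thesis
    proof (cases "(i, j) = (s, k)")
      case True
      \<comment> \<open>\<open>s\<close> is the largest stack position, so the invariant covers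
        everything between \<open>s\<close> and \<open>k\<close>.\<close>
      have "m \<notin> set st" if "s < m" for m using that 2(4) st by auto
      then have "\<exists>(i', j') \<in> P. (m = i' \<or> m = j') \<and> s < i' \<and> j' < k" if "s < m" "m < k" for m
        using that 2(6)[of s m] st by simp
      then show ?thesis using True 2(5) st by auto
    next
      case False
      then have "(i, j) \<in> set (match_scan (Suc k) st' as)" using 2(7) scan by auto
      then have "i < j \<and> (\<forall>m. i < m \<and> m < j \<longrightarrow>
          (\<exists>(i', j') \<in> ?P \<union> set (match_scan (Suc k) st' as). (m = i' \<or> m = j') \<and> i < i' \<and> j' < j))"
        using "2.IH"(3)[OF st(1) st(2) srt pre] by blast
      then show ?thesis unfolding scan by simp
    qed
  qed
qed simp

text \<open>The inequality says that in each prefix the ones do not outnumber the zeros plus the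
  open parentheses on the stack. Hence no closing parenthesis meets an empty stack.\<close>

lemma match_scan_closing:
  assumes "set as \<subseteq> {0, 1}" "\<And>r. r \<le> length as \<Longrightarrow> 2 * sum_list (take r as) \<le> r + length st"
  shows "set (map snd (match_scan k st as)) = {k + p | p. p < length as \<and> as ! p = 1}"
  using assms
proof (induction k st as rule: match_scan.induct)
  case (2 k st a as)
  have split: "{k + p | p. p < length (a # as) \<and> (a # as) ! p = 1} =
      (if a = 1 then {k} else {}) \<union> {Suc k + p | p. p < length as \<and> as ! p = 1}"
  proof -
    have ex_split: "(\<exists>p. R p) \<longleftrightarrow> R 0 \<or> (\<exists>p. R (Suc p))" for R :: "nat \<Rightarrow> bool"
      by (metis not0_implies_Suc)
    have "(\<exists>p. x = k + p \<and> p < length (a # as) \<and> (a # as) ! p = 1) \<longleftrightarrow>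
        (x = k \<and> a = 1) \<or> (\<exists>p. x = Suc k + p \<and> p < length as \<and> as ! p = 1)" for x
      by (subst ex_split) simp
    then show ?thesis by auto
  qed
  have step: "2 * (a + sum_list (take r as)) \<le> Suc r + length st" if "r \<le> length as" for r
    using 2(5)[of "Suc r"] that by simp
  show ?case
  proof (cases "a = 0")
    case True
    then show ?thesis using 2(1)[OF True] 2(4) step split by simp
  next
    case False
    then have a: "a = 1" using 2(4) by auto
    \<comment> \<open>At r = 0 the bound reads 2 \<le> 1 + \<open>length st\<close>.\<close>
    have "st \<noteq> []" using step[of 0] a by auto
    then obtain s st' where st: "st = s # st'" by (cases st) auto
    have "2 * sum_list (take r as) \<le> r + length st'" if "r \<le> length as" for r
      using step[OF that] a st by simp
    then show ?thesis using 2(3)[OF False st] 2(4) split a st by simp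
  qed
qed simp

lemma matching_distinct: "distinct (pair_entries (matching \<alpha>))"
  by (simp add: matching_def match_scan_distinct)

lemma matching_noncrossing: "noncrossing (matching \<alpha>)"
  using match_scan_noncrossing[of "[]" 1 "{}" _ _ \<alpha>]
  by (auto simp: noncrossing_def matching_def)

lemma matching_entries: "set (pair_entries (matching \<alpha>)) \<subseteq> {1..length \<alpha>}"
  using match_scan_entries[of 1 "[]" \<alpha>] by (auto simp: matching_def)

text \<open>The ballot condition lets every closing parenthesis be matched; \<open>Suc p\<close>
  converts list indices from 0 into positions from 1.\<close>

lemma matching_closing:
  assumes "\<alpha> \<in> ballot n"
  shows "set (map snd (matching \<alpha>)) = {Suc p | p. p < n \<and> \<alpha> ! p = 1}"
proof -
  have "2 * sum_list (take r \<alpha>) \<le> r" if "r \<le> length \<alpha>" for r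
  proof (cases "r = 0")
    case False
    then have "real (sum_list (take r \<alpha>)) \<le> real r / 2" using assms that by (auto simp: ballot_def)
    then show ?thesis by linarith
  qed simp
  then show ?thesis
    using match_scan_closing[of \<alpha> "[]" 1] assms by (auto simp: matching_def ballot_def)
qed

lemma matching_closing_inj:
  assumes "\<alpha> \<in> ballot n" "\<beta> \<in> ballot n"
    and "set (map snd (matching \<alpha>)) = set (map snd (matching \<beta>))"
  shows "\<alpha> = \<beta>"
proof (rule nth_equalityI)
  show "length \<alpha> = length \<beta>" using assms by (simp add: ballot_def)
next
  fix p assume p: "p < length \<alpha>"
  then have "Suc p \<in> set (map snd (matching \<alpha>)) \<longleftrightarrow> \<alpha> ! p = 1"
      "Suc p \<in> set (map snd (matching \<beta>)) \<longleftrightarrow> \<beta> ! p = 1"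
    using assms(1,2) unfolding matching_closing[OF assms(1)] matching_closing[OF assms(2)]
    by (auto simp: ballot_def)
  then have "\<alpha> ! p = 1 \<longleftrightarrow> \<beta> ! p = 1" using assms(3) by simp
  moreover have "\<alpha> ! p \<in> {0, 1}" "\<beta> ! p \<in> {0, 1}"
    using p assms(1,2) unfolding ballot_def by (metis (mono_tags, lifting) mem_Collect_eq nth_mem subsetD)+
  ultimately show "\<alpha> ! p = \<beta> ! p" by auto
qed

lemma Delta_eq_pair_prod:
  assumes "\<alpha> \<in> ballot n"
  shows "Delta n \<alpha> = pair_prod (matching \<alpha>)"
proof -
  interpret ring "ext_ring n" by (rule ring_ext_ring)
  \<comment> \<open>Subtraction in the ring record is pointwise here, by uniqueness of additive
    inverses in the carrier.\<close>
  have minus: "theta j \<ominus>\<^bsub>ext_ring n\<^esub> theta i = (\<lambda>A. theta j A - theta i A)"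
    if "i \<in> {1..n}" "j \<in> {1..n}" for i j
  proof -
    have th: "theta i \<in> carrier (ext_ring n)"
      using that by (auto simp: theta_def intro: theta_mon_closed)
    then have "(\<lambda>A. - theta i A) \<in> carrier (ext_ring n)" by (auto simp: ext_ring_def)
    then have "\<ominus>\<^bsub>ext_ring n\<^esub> theta i = (\<lambda>A. - theta i A)"
      using th by (intro minus_equality) (auto simp: ext_ring_def)
    then show ?thesis by (simp add: a_minus_def) (simp add: ext_ring_def)
  qed
  have "foldr (mult (ext_ring n)) (map (\<lambda>(i, j). theta j \<ominus>\<^bsub>ext_ring n\<^esub> theta i) xs)
      \<one>\<^bsub>ext_ring n\<^esub> = pair_prod xs" if "set (pair_entries xs) \<subseteq> {1..n}" for xs
    using that
  proof (induction xs)
    case (Cons x xs)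
    then show ?case by (cases x) (simp add: minus, simp add: ext_ring_def)
  qed (simp add: ext_ring_def)
  then show ?thesis using matching_entries[of \<alpha>] assms by (simp add: Delta_def ballot_def)
qed

theorem proposition2p10:
  fixes n :: nat
  assumes "n \<ge> 1"
  shows "Delta n ` ballot n \<subseteq> EQH n \<and>
    (\<forall>c :: nat list \<Rightarrow> rat.
      (\<Oplus>\<^bsub>ext_ring n\<^esub>\<alpha> \<in> ballot n. ext_smult (c \<alpha>) (Delta n \<alpha>)) = \<zero>\<^bsub>ext_ring n\<^esub> \<longrightarrow>
      (\<forall>\<alpha> \<in> ballot n. c \<alpha> = 0))"
proof (intro conjI allI impI)
  show "Delta n ` ballot n \<subseteq> EQH n"
  proof
    fix q assume "q \<in> Delta n ` ballot n"
    then obtain \<alpha> where \<alpha>: "\<alpha> \<in> ballot n" "q = Delta n \<alpha>" by auto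
    have q: "q \<in> carrier (ext_ring n)" using \<alpha> Delta_closed by simp
    have ent: "set (pair_entries (matching \<alpha>)) \<subseteq> {1..n}"
      using matching_entries[of \<alpha>] \<alpha>(1) by (simp add: ballot_def)
    have "(\<Sum>S\<in>Pow {1..n}. ext_mult (F_ones n r) b S * q S) = 0" if "r \<in> {1..n}" for r b
      using inner_F_ones_mult[OF matching_distinct matching_noncrossing ent] that \<alpha> Delta_eq_pair_prod by simp
    then have "(\<Sum>S\<in>Pow {1..n}. p S * q S) = 0" if "p \<in> I_ideal n" for p
      using ideal_orthogonal that by blast
    then show "q \<in> EQH n" using q by (simp add: EQH_def ext_inner_eq_sum)
  qed
next
  fix c :: "nat list \<Rightarrow> rat"
  assume z: "(\<Oplus>\<^bsub>ext_ring n\<^esub>\<alpha> \<in> ballot n. ext_smult (c \<alpha>) (Delta n \<alpha>)) = \<zero>\<^bsub>ext_ring n\<^esub>"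
  have "(\<Oplus>\<^bsub>ext_ring n\<^esub>\<alpha> \<in> ballot n. ext_smult (c \<alpha>) (Delta n \<alpha>)) =
      (\<lambda>B. \<Sum>\<alpha>\<in>ballot n. ext_smult (c \<alpha>) (Delta n \<alpha>) B)"
    by (rule finsum_ext_ring[OF finite_ballot]) (auto intro: ext_smult_closed Delta_closed)
  then have "(\<lambda>B. \<Sum>\<alpha>\<in>ballot n. c \<alpha> * Delta n \<alpha> B) = (\<lambda>B. 0)"
    using z by (simp add: ext_smult_def) (simp add: ext_ring_def)
  then have lin: "(\<Sum>\<alpha>\<in>ballot n. c \<alpha> * Delta n \<alpha> B) = 0" for B by meson
  define lead where "lead \<alpha> = set (map snd (matching \<alpha>))" for \<alpha>
  define N where "N = {\<alpha> \<in> ballot n. c \<alpha> \<noteq> 0}"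
  show "\<forall>\<alpha> \<in> ballot n. c \<alpha> = 0"
  proof (rule ccontr)
    assume "\<not> (\<forall>\<alpha> \<in> ballot n. c \<alpha> = 0)"
    then have "N \<noteq> {}" "finite N" using finite_ballot by (auto simp: N_def)
    \<comment> \<open>Among the sequences with nonzero coefficient, one whose leading monomial has
      the largest index sum is selected; ties are possible.\<close>
    then have "Max ((\<lambda>\<alpha>. \<Sum>(lead \<alpha>)) ` N) \<in> (\<lambda>\<alpha>. \<Sum>(lead \<alpha>)) ` N" by (intro Max_in) auto
    then obtain \<alpha> where \<alpha>: "\<alpha> \<in> N" and "\<Sum>(lead \<alpha>) = Max ((\<lambda>\<alpha>. \<Sum>(lead \<alpha>)) ` N)" by auto
    then have max: "\<Sum>(lead \<beta>) \<le> \<Sum>(lead \<alpha>)" if "\<beta> \<in> N" for \<beta>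
      using \<open>finite N\<close> that by simp
    \<comment> \<open>If \<open>lead \<alpha>\<close> occurred in the product for \<beta>, its index
      sum would be at most that of \<open>lead \<beta>\<close>; maximality gives equality, hence
      equal leading sets and \<beta> = \<alpha>. This also settles ties.\<close>
    have other: "c \<beta> * Delta n \<beta> (lead \<alpha>) = 0" if "\<beta> \<in> ballot n" "\<beta> \<noteq> \<alpha>" for \<beta>
    proof (rule ccontr)
      assume nz: "c \<beta> * Delta n \<beta> (lead \<alpha>) \<noteq> 0"
      then have "\<beta> \<in> N" "pair_prod (matching \<beta>) (lead \<alpha>) \<noteq> 0" using that by (auto simp: N_def Delta_eq_pair_prod)
      moreover have "\<forall>(i, j) \<in> set (matching \<beta>). i < j"
        using matching_noncrossing[of \<beta>] by (auto simp: noncrossing_def)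
      ultimately have "lead \<alpha> = lead \<beta>"
        using pair_prod_sum_le[OF _ matching_distinct, of \<beta> "lead \<alpha>"] max[of \<beta>]
        unfolding lead_def by (meson le_antisym)
      then show False
        using matching_closing_inj[of \<alpha> n \<beta>] \<alpha> that by (auto simp: lead_def N_def)
    qed
    have "(\<Sum>\<beta>\<in>ballot n - {\<alpha>}. c \<beta> * Delta n \<beta> (lead \<alpha>)) = 0"
      using other by (intro sum.neutral) blast
    then have "(\<Sum>\<beta>\<in>ballot n. c \<beta> * Delta n \<beta> (lead \<alpha>)) = c \<alpha> * Delta n \<alpha> (lead \<alpha>)"
      using \<alpha> finite_ballot[of n] sum.remove[of "ballot n" \<alpha> "\<lambda>\<beta>. c \<beta> * Delta n \<beta> (lead \<alpha>)"] by (simp add: N_def)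
    moreover have "Delta n \<alpha> (lead \<alpha>) \<noteq> 0"
      using \<alpha> pair_prod_leading_coeff[OF matching_distinct] by (simp add: Delta_eq_pair_prod N_def lead_def)
    ultimately show False using lin[of "lead \<alpha>"] \<alpha> by (simp add: N_def)
  qed
qed

end
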